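(* Let $R, S$ be two Dyck paths avoiding $NNN$, and let $P = \phi(R)$, $Q = \phi(S)$ be the corresponding Motzkin paths. Then $P \leq_{\mathcal{M}} Q$ if and only if $R \leq_D S$ and $\mathrm{Type}(R) = \mathrm{Type}(S)$ (that is, if and only if $[R,S]$ is a synchronized interval of Dyck paths avoiding $NNN$).
   Context: Paths: a Motzkin path is a non-empty lattice path in $\mathbb{Z}^2$ starting at $(0,0)$, ending on the diagonal $y=x$, staying weakly above the diagonal, with steps $N=(0,1)$, $E=(1,0)$, $D=(1,1)$. A Dyck path is a Motzkin path without $D$ steps. The size (length) of a path is its number of steps. Paths are viewed as words in $\{N,E,D\}$. $\mathcal{M}_n$ is the set of Motzkin paths of size $n$, $\mathcal{D}_{2n}$ the set of Dyck paths of size $2n$ ($n\ge 1$). Order: a valley of a path $P$ is a lattice point $v$ on $P$ preceded by an $E$ step and followed by an $N$ or $D$ step. Given a valley $v$ of a Motzkin path $P$, let $w$ be the next lattice point on $P$ after $v$ with the same horizontal distance to the diagonal as $v$ (the horizontal distance of $(a,b)$ is $b-a$). Exchanging the sub-path of $P$ between $v$ and $w$ with the $E$ step just before $v$ gives a Motzkin path $Q$; one says $Q$ covers $P$. The order $\leq_{\mathcal{M}}$ on $\mathcal{M}_n$ is the reflexive transitive closure of this covering relation. The same procedure applied to Dyck paths in $\mathcal{D}_{2n}$ gives the order $\leq_D$ (the Tamari lattice). Both orders only relate paths of the same size. Type: for $R\in\mathcal{D}_{2n}$, $\mathrm{Type}(R)$ is the word $w$ of length $n-1$ such that $w_i=N$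 if the $i$-th north step of $R$ is immediately followed by an east step, and $w_i=E$ otherwise. An interval $[R,S]$ (with $R\leq_D S$) is synchronized if $\mathrm{Type}(R)=\mathrm{Type}(S)$. The bijection $\phi$: a path avoids $NNN$ if it has no three consecutive $N$ steps. A Dyck path avoiding $NNN$ is uniquely written $R = N^{a_1}E^{b_1}\cdots N^{a_k}E^{b_k}$ with $a_i\in\{1,2\}$, $b_i\ge 1$. Set $\xi(1)=D$, $\xi(2)=N$, and $\phi(R)=\xi(a_1)E^{b_1-1}\cdots \xi(a_k)E^{b_k-1}$. This $\phi$ is a bijection from Dyck paths avoiding $NNN$ to Motzkin paths; $\phi^{-1}$ replaces each $D$ by $NE$ and each $N$ by $NNE$. *)

theory Defs
  imports Main "HOL-Library.Sublist"
begin

datatype step = N | E | D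

primrec step_vec :: "step \<Rightarrow> int \<times> int" where
  "step_vec N = (0, 1)"
| "step_vec E = (1, 0)"
| "step_vec D = (1, 1)"

text \<open>The lattice point reached from the origin after the first \<open>i\<close> steps.\<close>

definition point :: "step list \<Rightarrow> nat \<Rightarrow> int \<times> int" where
  "point P i = (\<Sum>k<i. fst (step_vec (P ! k)), \<Sum>k<i. snd (step_vec (P ! k)))"

definition hdist :: "int \<times> int \<Rightarrow> int" where
  "hdist p = snd p - fst p"

definition is_motzkin :: "step list \<Rightarrow> bool" where
  "is_motzkin P \<longleftrightarrow> P \<noteq> [] \<and>
     snd (point P (length P)) = fst (point P (length P)) \<and>
     (\<forall>i\<le>length P. fst (point P i) \<le> snd (point P i))"

definition is_dyck :: "step list \<Rightarrow> bool" where
  "is_dyck P \<longleftrightarrow> is_motzkin P \<and> D \<notin> set P"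

definition motzkin_paths :: "nat \<Rightarrow> step list set" where
  "motzkin_paths n = {P. is_motzkin P \<and> length P = n}"

text \<open>The argument is the number of steps, so the Dyck paths written \<open>D_2n\<close>
  informally are \<open>dyck_paths (2 * n)\<close>.\<close>

definition dyck_paths :: "nat \<Rightarrow> step list set" where
  "dyck_paths m = {P. is_dyck P \<and> length P = m}"

text \<open>Lattice points on a path are referred to by their index, the number of steps preceding them.\<close>

definition is_valley :: "step list \<Rightarrow> nat \<Rightarrow> bool" where
  "is_valley P i \<longleftrightarrow> 0 < i \<and> i < length P \<and> P ! (i - 1) = E \<and> P ! i \<in> {N, D}"

definition is_next_level :: "step list \<Rightarrow> nat \<Rightarrow> nat \<Rightarrow> bool" where
  "is_next_level P i j \<longleftrightarrow> i < j \<and> j \<le> length P \<and>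
     hdist (point P j) = hdist (point P i) \<and>
     (\<forall>k. i < k \<and> k < j \<longrightarrow> hdist (point P k) \<noteq> hdist (point P i))"

text \<open>\<open>covers Q P\<close>: \<open>Q\<close> covers \<open>P\<close>, so \<open>Q\<close> is the larger path.\<close>

definition covers :: "step list \<Rightarrow> step list \<Rightarrow> bool" where
  "covers Q P \<longleftrightarrow> (\<exists>i j. is_valley P i \<and> is_next_level P i j \<and>
     Q = take (i - 1) P @ drop i (take j P) @ [E] @ drop j P)"

text \<open>The reflexive transitive closure of the covering relation on a set \<open>X\<close> of paths.\<close>

definition path_le_on :: "step list set \<Rightarrow> step list \<Rightarrow> step list \<Rightarrow> bool" where
  "path_le_on X P Q \<longleftrightarrow> P \<in> X \<and> Q \<in> X \<and>
     (\<lambda>P Q. P \<in> X \<and> Q \<in> X \<and> covers Q P)\<^sup>*\<^sup>* P Q"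

definition motzkin_le :: "step list \<Rightarrow> step list \<Rightarrow> bool" (infix "\<le>\<^sub>M" 50) where
  "P \<le>\<^sub>M Q \<longleftrightarrow> (\<exists>n. path_le_on (motzkin_paths n) P Q)"

definition dyck_le :: "step list \<Rightarrow> step list \<Rightarrow> bool" (infix "\<le>\<^sub>D" 50) where
  "R \<le>\<^sub>D S \<longleftrightarrow> (\<exists>n. path_le_on (dyck_paths (2 * n)) R S)"

definition north_positions :: "step list \<Rightarrow> nat list" where
  "north_positions R = filter (\<lambda>k. R ! k = N) [0..<length R]"

text \<open>The word has length \<open>n - 1\<close> for a Dyck path of size \<open>2n\<close>: the last north step,
  which is always followed by an east step, is left out.\<close>

definition Type :: "step list \<Rightarrow> step list" where
  "Type R = map (\<lambda>i. if R ! Suc (north_positions R ! i) = E then N else E)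
              [0..<length R div 2 - 1]"

definition avoids_NNN :: "step list \<Rightarrow> bool" where
  "avoids_NNN R \<longleftrightarrow> \<not> sublist [N, N, N] R"

text \<open>The pairs \<open>(a, b)\<close> are the exponents in the factorisation of a path into factors
  \<open>N\<^sup>a E\<^sup>b\<close> with \<open>a \<in> {1, 2}\<close> and \<open>b \<ge> 1\<close>.\<close>

definition is_factorisation :: "(nat \<times> nat) list \<Rightarrow> step list \<Rightarrow> bool" where
  "is_factorisation ab R \<longleftrightarrow> (\<forall>(a, b)\<in>set ab. a \<in> {1, 2} \<and> 1 \<le> b) \<and>
     R = concat (map (\<lambda>(a, b). replicate a N @ replicate b E) ab)"

definition xi :: "nat \<Rightarrow> step" where
  "xi a = (if a = 1 then D else N)"

text \<open>Only meaningful for Dyck paths avoiding \<open>NNN\<close>, where the factorisation exists and is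
  unique (\<open>ex1_factorisation\<close> below).\<close>

definition phi :: "step list \<Rightarrow> step list" where
  "phi R = concat (map (\<lambda>(a, b). xi a # replicate (b - 1) E) (THE ab. is_factorisation ab R))"

lemma factorisation_Cons:
  "is_factorisation ((a, b) # ab) R \<longleftrightarrow> a \<in> {1, 2} \<and> 1 \<le> b \<and>
     (\<exists>R'. R = replicate a N @ replicate b E @ R' \<and> is_factorisation ab R')"
  by (auto simp: is_factorisation_def)

lemma factorisation_hd:
  "is_factorisation ab R \<Longrightarrow> R = [] \<or> (\<exists>R'. R = N # R')"
proof (cases ab)
  case (Cons p ab')
  then obtain a b where "ab = (a, b) # ab'" by (cases p) simp
  moreover assume "is_factorisation ab R"
  ultimately show ?thesis by (auto simp: factorisation_Cons numeral_2_eq_2)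
qed (simp add: is_factorisation_def)

lemma factorisation_exponents:
  assumes "1 \<le> a" "1 \<le> b" "R = replicate a N @ replicate b E @ R'" "R' = [] \<or> (\<exists>R''. R' = N # R'')"
  shows "a = length (takeWhile (\<lambda>s. s = N) R)"
    and "b = length (takeWhile (\<lambda>s. s = E) (drop a R))"
proof -
  obtain b' where b': "b = Suc b'" using assms(2) by (cases b) auto
  have "takeWhile (\<lambda>s. s = N) R = replicate a N"
    unfolding assms(3) b' by (subst takeWhile_append2) auto
  then show "a = length (takeWhile (\<lambda>s. s = N) R)" by simp
  have "takeWhile (\<lambda>s. s = E) (drop a R) = takeWhile (\<lambda>s. s = E) (replicate b E @ R')"
    unfolding assms(3) by simp
  also have "\<dots> = replicate b E @ takeWhile (\<lambda>s. s = E) R'"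
    by (subst takeWhile_append2) auto
  also have "takeWhile (\<lambda>s. s = E) R' = []" using assms(4) by auto
  finally show "b = length (takeWhile (\<lambda>s. s = E) (drop a R))" by simp
qed

lemma factorisation_unique:
  "is_factorisation ab R \<Longrightarrow> is_factorisation ab' R \<Longrightarrow> ab = ab'"
proof (induction ab arbitrary: ab' R)
  case Nil
  then show ?case
    by (cases ab') (auto simp: is_factorisation_def)
next
  case (Cons p ab)
  obtain a b where p: "p = (a, b)" by (cases p)
  from Cons.prems(1) obtain R1 where
    1: "1 \<le> a" "1 \<le> b" "R = replicate a N @ replicate b E @ R1" "is_factorisation ab R1"
    unfolding p factorisation_Cons by auto
  have "R \<noteq> []" using 1(1,3) by simp
  then have "ab' \<noteq> []" using Cons.prems(2) by (auto simp: is_factorisation_def)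
  then obtain a' b' ab'' where ab': "ab' = (a', b') # ab''"
    by (metis list.exhaust surj_pair)
  from Cons.prems(2) obtain R2 where
    2: "1 \<le> a'" "1 \<le> b'" "R = replicate a' N @ replicate b' E @ R2" "is_factorisation ab'' R2"
    unfolding ab' factorisation_Cons by auto
  note e1 = factorisation_exponents[OF 1(1-3) factorisation_hd[OF 1(4)]]
  note e2 = factorisation_exponents[OF 2(1-3) factorisation_hd[OF 2(4)]]
  have a: "a = a'" using e1(1) e2(1) by simp
  have b: "b = b'" using e1(2) e2(2) a by simp
  have "R1 = R2" using 1(3) 2(3) a b by simp
  then show ?case using Cons.IH 1(4) 2(4) a b p ab' by blast
qed

lemma factorisation_exists:
  assumes "avoids_NNN R" "D \<notin> set R" "R = [] \<or> hd R = N \<and> last R = E"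
  shows "\<exists>ab. is_factorisation ab R"
  using assms
proof (induction "length R" arbitrary: R rule: less_induct)
  case less
  show ?case
  proof (cases "R = []")
    case True
    then show ?thesis by (auto simp: is_factorisation_def intro: exI[of _ "[]"])
  next
    case False
    have "\<exists>a R1. a \<in> {1, 2} \<and> R = replicate a N @ E # R1"
    proof -
      from False less.prems(3) obtain R1 where R1: "R = N # R1" "last R = E"
        by (cases R) auto
      then obtain s R2 where R2: "R1 = s # R2" by (cases R1) auto
      show ?thesis
      proof (cases "s = N")
        case True
        then obtain t R3 where R3: "R2 = t # R3" using R1 R2 by (cases R2) auto
        have "t \<noteq> N"
        proof
          assume "t = N"
          then have "R = [] @ [N, N, N] @ R3" using R1 R2 R3 True by simp
          then show False using less.prems(1) unfolding avoids_NNN_def sublist_def by blast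
        qed
        then have "t = E" using less.prems(2) R1 R2 R3 by (cases t) auto
        then have "R = replicate 2 N @ E # R3" using R1 R2 R3 True by (simp add: numeral_2_eq_2)
        then show ?thesis by blast
      next
        case False
        then have "s = E" using less.prems(2) R1 R2 by (cases s) auto
        then have "R = replicate 1 N @ E # R2" using R1 R2 by simp
        then show ?thesis by blast
      qed
    qed
    then obtain a R1 where a: "a \<in> {1, 2}" "R = replicate a N @ E # R1" by blast
    define b R' where "b = Suc (length (takeWhile (\<lambda>s. s = E) R1))"
      and "R' = dropWhile (\<lambda>s. s = E) R1"
    have "R1 = replicate (b - 1) E @ R'"
      unfolding b_def R'_def by (induction R1) auto
    then have R: "R = replicate a N @ replicate b E @ R'"
      using a(2) by (simp add: b_def)
    have "avoids_NNN R'"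
      using less.prems(1) unfolding avoids_NNN_def R
      by (simp add: sublist_append)
    moreover have D: "D \<notin> set R'" using less.prems(2) R by auto
    moreover have "hd R' = N \<and> last R' = E" if "R' \<noteq> []"
    proof
      have "hd R' \<noteq> E" using that hd_dropWhile[of "\<lambda>s. s = E" R1] by (simp add: R'_def)
      moreover have "hd R' \<noteq> D" using D that hd_in_set by metis
      ultimately show "hd R' = N" by (cases "hd R'") auto
      show "last R' = E" using less.prems(3) False R that by simp
    qed
    moreover have "length R' < length R" using R by (simp add: b_def)
    ultimately obtain ab where "is_factorisation ab R'" using less.hyps by blast
    then have "is_factorisation ((a, b) # ab) R"
      unfolding factorisation_Cons using a(1) R by (auto simp: b_def)
    then show ?thesis by blast
  qed
qed

lemma ex1_factorisation:
  assumes "is_dyck R" "avoids_NNN R"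
  shows "\<exists>!ab. is_factorisation ab R"
proof -
  from assms(1) have R: "R \<noteq> []" "D \<notin> set R" "snd (point R (length R)) = fst (point R (length R))"
    "\<And>i. i \<le> length R \<Longrightarrow> fst (point R i) \<le> snd (point R i)"
    by (auto simp: is_dyck_def is_motzkin_def)
  have "1 \<le> length R" using R(1) by (cases R) auto
  then have "R ! 0 \<noteq> E" using R(4)[of 1] by (auto simp: point_def)
  then have "hd R = N" using R(1,2) by (metis hd_conv_nth hd_in_set step.exhaust)
  moreover have "last R = E"
  proof -
    define m where "m = length R - 1"
    have m: "length R = Suc m" using R(1) by (simp add: m_def)
    have "R ! m \<noteq> N"
      using R(3) R(4)[of m] by (auto simp: m point_def)
    then show ?thesis using R(1,2) by (metis last_conv_nth last_in_set m_def step.exhaust)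
  qed
  ultimately have "\<exists>ab. is_factorisation ab R"
    using factorisation_exists[OF assms(2) R(2)] by blast
  then show ?thesis using factorisation_unique by blast
qed

end

theory Submission
  imports Defs
begin

text \<open>A covering step moves an \<open>E\<close> across a primitive excursion \<open>X\<close>, turning \<open>A E X B\<close> into
  \<open>A X E B\<close>. The inverse \<open>psi\<close> of \<open>phi\<close> acts letterwise, maps primitive excursions to primitive
  excursions, and so maps Motzkin covers to Dyck covers of equal type. Conversely, a Dyck cover
  keeps the type if \<open>A\<close> does not end in \<open>N\<close>, and otherwise turns one letter \<open>N\<close> of the type into
  \<open>E\<close>. Hence, along a chain whose two ends have the same type, every cover is of the first kind.
  Such a cover of a path \<open>psi P\<close> cuts it only at block boundaries and therefore lifts to a
  Motzkin cover of \<open>P\<close>; in particular the intermediate paths avoid \<open>NNN\<close>.\<close>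

section \<open>Heights of words and a recursive form of the path condition\<close>

definition rise :: "step \<Rightarrow> int" where
  "rise s = snd (step_vec s) - fst (step_vec s)"

lemma rise_simps [simp]: "rise N = 1" "rise E = -1" "rise D = 0"
  by (auto simp: rise_def)

definition height :: "step list \<Rightarrow> int" where
  "height w = sum_list (map rise w)"

lemma height_simps [simp]:
  "height [] = 0" "height (s # w) = rise s + height w" "height (u @ v) = height u + height v"
  by (auto simp: height_def)

lemma hdist_point: "i \<le> length P \<Longrightarrow> hdist (point P i) = height (take i P)"
proof (induction i)
  case (Suc i)
  then show ?case
    by (simp add: take_Suc_conv_app_nth hdist_def point_def rise_def)
qed (simp add: hdist_def point_def)

text \<open>The starting height is a parameter so that suffixes of paths can be handled by
  induction.\<close>

fun path_from :: "int \<Rightarrow> step list \<Rightarrow> bool" where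
  "path_from h [] \<longleftrightarrow> h = 0"
| "path_from h (s # w) \<longleftrightarrow> 0 \<le> h \<and> path_from (h + rise s) w"

lemma path_from_iff:
  "path_from h w \<longleftrightarrow> h + height w = 0 \<and> (\<forall>i\<le>length w. 0 \<le> h + height (take i w))"
proof (induction w arbitrary: h)
  case (Cons s w)
  have "(\<forall>i\<le>length (s # w). 0 \<le> h + height (take i (s # w))) \<longleftrightarrow>
    0 \<le> h \<and> (\<forall>i\<le>length w. 0 \<le> h + rise s + height (take i w))"
    by (auto simp: less_Suc_eq_le[symmetric] All_less_Suc2 add.assoc)
  then show ?case by (auto simp: Cons.IH add.assoc)
qed auto

lemma is_motzkin_iff: "is_motzkin P \<longleftrightarrow> P \<noteq> [] \<and> path_from 0 P"
proof -
  have "snd (point P (length P)) = fst (point P (length P)) \<longleftrightarrow> height P = 0"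
    using hdist_point[of "length P" P] by (auto simp: hdist_def)
  moreover have "fst (point P i) \<le> snd (point P i) \<longleftrightarrow> 0 \<le> height (take i P)"
    if "i \<le> length P" for i
    using hdist_point[OF that] by (auto simp: hdist_def)
  ultimately show ?thesis unfolding is_motzkin_def path_from_iff by auto
qed

lemma path_from_nonneg: "path_from h w \<Longrightarrow> 0 \<le> h"
  by (cases w) auto

lemma not_path_from_snoc_N [simp]: "\<not> path_from h (w @ [N])"
  by (induction w arbitrary: h) auto

section \<open>Primitive excursions and covers as rewriting of words\<close>

definition primitive :: "step list \<Rightarrow> bool" where
  "primitive X \<longleftrightarrow> X = [D] \<or> (\<exists>M. X = N # M @ [E] \<and> path_from 0 M)"

text \<open>The right side is a first return to the starting level, as in
  \<open>is_next_level\<close>. A step lowers the height by at most 1, so a word that has risen to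
  height 1 cannot pass below 0 without hitting it: it stays positive until a final
  \<open>E\<close>.\<close>

lemma primitive_iff:
  "primitive X \<longleftrightarrow> X \<noteq> [] \<and> hd X \<in> {N, D} \<and> height X = 0 \<and>
     (\<forall>k. 0 < k \<and> k < length X \<longrightarrow> height (take k X) \<noteq> 0)"
  (is "_ \<longleftrightarrow> ?r")
proof
  assume "primitive X"
  then consider "X = [D]" | M where "X = N # M @ [E]" "path_from 0 M"
    by (auto simp: primitive_def)
  then show ?r
  proof cases
    case 2
    have "height (take k X) \<noteq> 0" if k: "0 < k" "k < length X" for k
    proof -
      obtain k' where k': "k = Suc k'" "k' \<le> length M" using k 2(1) by (cases k) auto
      then have "0 \<le> height (take k' M)" using 2(2) by (simp add: path_from_iff)
      then show ?thesis using 2(1) k' by simp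
    qed
    then show ?thesis using 2 by (auto simp: path_from_iff)
  qed auto
next
  assume r: ?r
  then obtain s Y where X: "X = s # Y" "s \<in> {N, D}" by (cases X) auto
  show "primitive X"
  proof (cases "s = D")
    case True
    \<comment> \<open>A longer word would already be back at height 0 after its first letter
      \<open>D\<close>.\<close>
    have "Y = []"
      using r X True by (auto dest: spec[of _ 1])
    then show ?thesis using True X by (simp add: primitive_def)
  next
    case False
    then have N: "X = N # Y" using X by auto
    then have "Y \<noteq> []" using r by auto
    then obtain M t where Y: "Y = M @ [t]" by (metis rev_exhaust)
    \<comment> \<open>Heights in \<open>M\<close> are relative to level 1, so the value -1 would be
      an early return of \<open>X\<close>.\<close>
    have pos: "0 \<le> height (take k M)" if "k \<le> length M" for k
      using that
    proof (induction k)
      case (Suc k)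
      have "height (take (Suc (Suc k)) X) \<noteq> 0"
        using r Suc.prems N Y by (auto dest!: spec[of _ "Suc (Suc k)"])
      then have "1 + height (take (Suc k) M) \<noteq> 0" using N Y Suc.prems by simp
      moreover have "height (take (Suc k) M) = height (take k M) + rise (M ! k)"
        using Suc.prems by (simp add: take_Suc_conv_app_nth)
      moreover have "-1 \<le> rise (M ! k)" by (cases "M ! k") auto
      ultimately show ?case using Suc by linarith
    qed simp
    have "0 \<le> height M" using pos[of "length M"] by simp
    moreover have "1 + height M + rise t = 0" using r N Y by simp
    ultimately have "t = E" "height M = 0" by (cases t; simp)+
    then show ?thesis using N Y pos by (simp add: primitive_def path_from_iff)
  qed
qed

lemma covers_iff:
  "covers Q P \<longleftrightarrow> (\<exists>A X B. P = A @ E # X @ B \<and> Q = A @ X @ E # B \<and> primitive X)"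
proof
  assume "covers Q P"
  then obtain i j where v: "is_valley P i" and n: "is_next_level P i j"
    and Q: "Q = take (i - 1) P @ drop i (take j P) @ [E] @ drop j P"
    unfolding covers_def by blast
  define A X B where "A = take (i - 1) P" and "X = drop i (take j P)" and "B = drop j P"
  have ij: "0 < i" "i < j" "j \<le> length P" "P ! (i - 1) = E" "P ! i \<in> {N, D}"
    using v n by (auto simp: is_valley_def is_next_level_def)
  have Ai: "take i P = A @ [E]"
    using ij take_Suc_conv_app_nth[of "i - 1" P] by (simp add: A_def)
  have "take j P = take i P @ X"
    using ij by (metis X_def append_take_drop_id less_imp_le min.absorb1 take_take)
  then have P: "P = A @ E # X @ B"
    using Ai append_take_drop_id[of j P] by (simp add: B_def)
  have i: "i = Suc (length A)" using ij by (simp add: A_def)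
  have j: "j = i + length X" using ij by (simp add: X_def)
  have "X \<noteq> []" using ij j by auto
  have "hd X = P ! i" using P i \<open>X \<noteq> []\<close> by (cases X) (auto simp: nth_append)
  \<comment> \<open>Heights in \<open>X\<close> are measured from the valley, so points at the level
    of the valley are those of height 0.\<close>
  have tk: "hdist (point P (i + k)) = hdist (point P i) + height (take k X)" if "k \<le> length X" for k
    using that ij j P i by (simp add: hdist_point)
  have "height X = 0" using tk[of "length X"] n j by (simp add: is_next_level_def)
  moreover have "height (take k X) \<noteq> 0" if "0 < k" "k < length X" for k
  proof
    assume "height (take k X) = 0"
    then have "hdist (point P (i + k)) = hdist (point P i)" using tk[of k] that by simp
    then show False using n that j by (auto simp: is_next_level_def)
  qed
  ultimately have "primitive X"
    unfolding primitive_iff using \<open>X \<noteq> []\<close> \<open>hd X = P ! i\<close> ij by auto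
  moreover have "Q = A @ X @ E # B" using Q by (simp add: A_def X_def B_def)
  ultimately show "\<exists>A X B. P = A @ E # X @ B \<and> Q = A @ X @ E # B \<and> primitive X"
    using P by blast
next
  assume "\<exists>A X B. P = A @ E # X @ B \<and> Q = A @ X @ E # B \<and> primitive X"
  then obtain A X B where P: "P = A @ E # X @ B" and Q: "Q = A @ X @ E # B"
    and X: "X \<noteq> []" "hd X \<in> {N, D}" "height X = 0"
      "\<And>k. 0 < k \<Longrightarrow> k < length X \<Longrightarrow> height (take k X) \<noteq> 0"
    by (auto simp: primitive_iff)
  define i j where "i = Suc (length A)" and "j = i + length X"
  have tk: "hdist (point P (i + k)) = hdist (point P i) + height (take k X)" if "k \<le> length X" for k
    using that P by (simp add: i_def hdist_point)
  have "is_valley P i"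
    using P X by (cases X) (auto simp: is_valley_def i_def nth_append)
  moreover have "is_next_level P i j"
    unfolding is_next_level_def
  proof (intro conjI allI impI)
    show "i < j" using X(1) by (simp add: j_def)
    show "j \<le> length P" using P by (simp add: i_def j_def)
    show "hdist (point P j) = hdist (point P i)" using tk[of "length X"] X(3) by (simp add: j_def)
    fix k assume k: "i < k \<and> k < j"
    then have "k - i \<le> length X" "0 < k - i" "k - i < length X" by (auto simp: j_def)
    then show "hdist (point P k) \<noteq> hdist (point P i)"
      using k tk[of "k - i"] X(4)[of "k - i"] by simp
  qed
  moreover have "Q = take (i - 1) P @ drop i (take j P) @ [E] @ drop j P"
    using P Q by (simp add: i_def j_def)
  ultimately show "covers Q P" unfolding covers_def by blast
qed

section \<open>The letterwise inverse of \<open>phi\<close>\<close>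

primrec psi_step :: "step \<Rightarrow> step list" where
  "psi_step N = [N, N, E]"
| "psi_step E = [E]"
| "psi_step D = [N, E]"

definition psi :: "step list \<Rightarrow> step list" where
  "psi w = concat (map psi_step w)"

lemma psi_simps [simp]:
  "psi [] = []" "psi (s # w) = psi_step s @ psi w" "psi (u @ v) = psi u @ psi v"
  by (auto simp: psi_def)

lemma psi_eq_Nil_iff [simp]: "psi w = [] \<longleftrightarrow> w = []"
proof (cases w)
  case (Cons s v)
  then show ?thesis by (cases s) auto
qed simp

lemma D_notin_psi [simp]: "D \<notin> set (psi w)"
proof (induction w)
  case (Cons s w)
  then show ?case by (cases s) auto
qed simp

text \<open>The blocks for \<open>N\<close> and \<open>D\<close> never go below their starting
  height, and each block has the same total rise as its letter.\<close>

lemma path_from_psi_append [simp]: "path_from h (psi w @ v) \<longleftrightarrow> path_from h (w @ v)"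
proof (induction w arbitrary: h)
  case (Cons s w)
  show ?case by (cases s) (auto simp: Cons.IH add.commute)
qed simp

lemma path_from_psi [simp]: "path_from h (psi w) \<longleftrightarrow> path_from h w"
  using path_from_psi_append[of h w "[]"] by simp

text \<open>Each block has length 2 plus the rise of its letter. On paths of total height 0,
  \<open>psi\<close> therefore doubles the length.\<close>

lemma length_psi: "int (length (psi w)) = 2 * int (length w) + height w"
proof (induction w)
  case (Cons s w)
  then show ?case by (cases s) auto
qed simp

lemma psi_in_dyck_paths: "psi P \<in> dyck_paths (2 * n) \<longleftrightarrow> P \<in> motzkin_paths n"
proof -
  have "length (psi P) = 2 * n \<longleftrightarrow> length P = n" if "path_from 0 P"
    using that length_psi[of P] by (auto simp: path_from_iff)
  then show ?thesis
    by (auto simp: dyck_paths_def motzkin_paths_def is_dyck_def is_motzkin_iff)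
qed

text \<open>Each block contains exactly one \<open>E\<close>, at its end, so a prefix ending in
  \<open>E\<close> consists of whole blocks.\<close>

lemma psi_split:
  assumes "psi P = A @ v" "A = [] \<or> last A = E"
  obtains P1 P2 where "P = P1 @ P2" "psi P1 = A" "psi P2 = v"
  using assms
proof (induction P arbitrary: A thesis)
  case Nil
  then show ?case by simp
next
  case (Cons s P)
  show ?case
  proof (cases "A = []")
    case True
    then show ?thesis using Cons.prems(1)[of "[]" "s # P"] Cons.prems(2) by simp
  next
    case False
    then have "last A = E" using Cons.prems(3) by simp
    then obtain A' where A': "A = psi_step s @ A'" "A' = [] \<or> last A' = E" "psi P = A' @ v"
      using Cons.prems(2) False
      by (cases s) (auto simp: Cons_eq_append_conv split: if_splits)
    then obtain P1 P2 where "P = P1 @ P2" "psi P1 = A'" "psi P2 = v"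
      using Cons.IH by blast
    then show ?thesis using Cons.prems(1)[of "s # P1" P2] A'(1) by simp
  qed
qed

text \<open>The blocks are non-empty and none is a prefix of another.\<close>

lemma psi_inject: "psi u = psi v \<Longrightarrow> u = v"
proof (induction u arbitrary: v)
  case Nil
  then show ?case by (metis psi_eq_Nil_iff psi_simps(1))
next
  case (Cons s u)
  then have "v \<noteq> []" by (metis list.discI psi_eq_Nil_iff)
  then obtain t v' where v: "v = t # v'" by (cases v) auto
  then show ?case using Cons by (cases s; cases t) auto
qed

text \<open>The point of the backward direction: if \<open>X\<close> starts with \<open>N\<close>
  and its last letter is \<open>N\<close> or \<open>D\<close>, then the last block makes
  \<open>M\<close> end in \<open>N\<close>, impossible for a nonnegative path ending at height
  0.\<close>

lemma primitive_psi: "primitive (psi X) \<longleftrightarrow> primitive X"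
proof
  assume "primitive X"
  then consider "X = [D]" | M where "X = N # M @ [E]" "path_from 0 M"
    by (auto simp: primitive_def)
  then show "primitive (psi X)"
  proof cases
    case 2
    then have "psi X = N # (N # E # psi M) @ [E]" "path_from 0 (N # E # psi M)" by simp_all
    then show ?thesis unfolding primitive_def by blast
  qed (simp add: primitive_def)
next
  assume "primitive (psi X)"
  moreover have "psi X \<noteq> [D]" by (metis D_notin_psi list.set_intros(1))
  ultimately obtain M where M: "psi X = N # M @ [E]" "path_from 0 M"
    by (auto simp: primitive_def)
  then obtain s Y where X: "X = s # Y" by (cases X) auto
  show "primitive X"
  proof (cases s)
    case E
    then show ?thesis using X M by simp
  next
    case D
    then have "E # psi Y = M @ [E]" using X M by simp
    \<comment> \<open>A non-empty \<open>M\<close> would start with \<open>E\<close> and fall below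
      height 0.\<close>
    then have "Y = []" using M(2) by (cases M) (auto dest: path_from_nonneg)
    then show ?thesis using D X by (simp add: primitive_def)
  next
    case N
    then have eq: "N # E # psi Y = M @ [E]" using X M by simp
    then have "Y \<noteq> []"
      using M(2) not_path_from_snoc_N[of 0 "[]"] by (auto simp: Cons_eq_append_conv)
    then obtain Z t where Z: "Y = Z @ [t]" by (metis rev_exhaust)
    show ?thesis
    proof (cases t)
      case N
      then have "M = (N # E # psi Z @ [N]) @ [N]" using eq Z by simp
      then show ?thesis using M(2) not_path_from_snoc_N by metis
    next
      case D
      then have "M = (N # E # psi Z) @ [N]" using eq Z by simp
      then show ?thesis using M(2) not_path_from_snoc_N by metis
    next
      case E
      then have "M = N # E # psi Z" using eq Z by simp
      then have "path_from 0 Z" using M(2) by simp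
      then show ?thesis using X \<open>s = N\<close> Z E by (simp add: primitive_def)
    qed
  qed
qed

text \<open>The block of \<open>xi a\<close> supplies the \<open>a\<close> north steps and the first
  \<open>E\<close>, which matches the exponent \<open>b - 1\<close> in \<open>phi\<close>.\<close>

lemma psi_phi:
  assumes "is_dyck R" "avoids_NNN R"
  shows "psi (phi R) = R"
proof -
  have E: "psi (replicate b E) = replicate b E" for b by (induction b) auto
  have *: "psi (concat (map (\<lambda>(a, b). xi a # replicate (b - 1) E) ab)) = R"
    if "is_factorisation ab R" for ab R
    using that
  proof (induction ab arbitrary: R)
    case Nil
    then show ?case by (simp add: is_factorisation_def)
  next
    case (Cons p ab)
    obtain a b where p: "p = (a, b)" by (cases p)
    with Cons.prems obtain R' where R': "a \<in> {1, 2}" "1 \<le> b"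
      "R = replicate a N @ replicate b E @ R'" "is_factorisation ab R'"
      by (auto simp: factorisation_Cons)
    obtain b' where "b = Suc b'" using R'(2) by (cases b) auto
    then show ?case using Cons.IH[OF R'(4)] R'(1,3) p
      by (auto simp: E xi_def numeral_2_eq_2)
  qed
  show ?thesis unfolding phi_def
    by (rule *, rule theI', rule ex1_factorisation[OF assms])
qed

section \<open>Types by recursion on words\<close>

fun type_word :: "step list \<Rightarrow> step list" where
  "type_word [] = []"
| "type_word (N # w) = (if w \<noteq> [] \<and> hd w = E then N else E) # type_word w"
| "type_word (_ # w) = type_word w"

lemma north_positions_Cons:
  "north_positions (s # R) = (if s = N then [0] else []) @ map Suc (north_positions R)"
proof -
  have "[0..<length (s # R)] = 0 # map Suc [0..<length R]"
    by (simp add: map_Suc_upt upt_conv_Cons del: upt_Suc)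
  then show ?thesis by (simp add: north_positions_def filter_map o_def)
qed

lemma type_word_conv:
  "type_word R =
    map (\<lambda>k. if Suc k < length R \<and> R ! Suc k = E then N else E) (north_positions R)"
proof (induction R)
  case (Cons s R)
  then show ?case
    by (cases s) (auto simp: north_positions_Cons hd_conv_nth)
qed (simp add: north_positions_def)

lemma length_north_positions:
  "D \<notin> set R \<Longrightarrow> 2 * int (length (north_positions R)) = int (length R) + height R"
proof (induction R)
  case (Cons s R)
  then show ?case by (cases s) (auto simp: north_positions_Cons)
qed (simp add: north_positions_def)

text \<open>\<open>Type\<close> looks up the successor of a north step without a bounds check. A
  Dyck path does not end in \<open>N\<close>, so the check in \<open>type_word_conv\<close> always
  succeeds.\<close>

lemma Type_eq:
  assumes "is_dyck R"
  shows "Type R = butlast (type_word R)"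
proof -
  let ?f = "\<lambda>k. if R ! Suc k = E then N else E"
  have R: "path_from 0 R" "R \<noteq> []" "D \<notin> set R"
    using assms by (auto simp: is_dyck_def is_motzkin_iff)
  have len: "length (north_positions R) = length R div 2"
    using length_north_positions[OF R(3)] R(1) by (simp add: path_from_iff)
  have "Suc k < length R" if "k \<in> set (north_positions R)" for k
  proof (rule ccontr)
    assume "\<not> Suc k < length R"
    then have "length R = Suc k" "R ! k = N" using that by (auto simp: north_positions_def)
    then have "R = take k R @ [N]" by (metis lessI order_refl take_Suc_conv_app_nth take_all)
    then show False using R(1) not_path_from_snoc_N by metis
  qed
  then have "type_word R = map ?f (north_positions R)"
    unfolding type_word_conv by auto
  then have "butlast (type_word R) = map ?f (take (length R div 2 - 1) (north_positions R))"
    by (simp add: butlast_conv_take len take_map)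
  also have "take (length R div 2 - 1) (north_positions R)
      = map ((!) (north_positions R)) [0..<length R div 2 - 1]"
    by (simp add: list_eq_iff_nth_eq len)
  finally show ?thesis by (simp add: Type_def)
qed

text \<open>An entry depends only on the letter after its \<open>N\<close>, so no entry before an
  \<open>E\<close> sees beyond that \<open>E\<close>.\<close>

lemma type_word_append_E: "type_word (u @ E # v) = type_word (u @ [E]) @ type_word v"
proof (induction u)
  case (Cons s u)
  then show ?case by (cases s) (auto simp: hd_append)
qed simp

text \<open>The order of quantifiers matters: one \<open>c\<close> serves for both paths of a
  cover.\<close>

lemma type_word_append_N: "\<exists>c. \<forall>v. type_word (u @ N # v) = c @ type_word (N # v)"
proof (induction u)
  case Nil
  show ?case by (intro exI[of _ "[]"]) simp
next
  case (Cons s u)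
  then obtain c where c: "\<And>v. type_word (u @ N # v) = c @ type_word (N # v)" by blast
  show ?case
  proof (cases "s = N")
    case True
    then show ?thesis using c
      by (intro exI[of _ "(if u \<noteq> [] \<and> hd u = E then N else E) # c"]) (auto simp: hd_append)
  next
    case False
    then show ?thesis using c by (intro exI[of _ c]) (cases s; simp)
  qed
qed

text \<open>After the last north step come only letters \<open>E\<close>, at least one. Its entry is
  thus fixed, and types can be compared with it included.\<close>

lemma last_type_word:
  assumes "is_dyck R"
  shows "type_word R \<noteq> [] \<and> last (type_word R) = N"
proof -
  have R: "path_from 0 R" "R \<noteq> []" "D \<notin> set R"
    using assms by (auto simp: is_dyck_def is_motzkin_iff)
  obtain s R' where R': "R = s # R'" using R(2) by (cases R) auto
  then have "s = N" using R(1,3) by (cases s; cases R') auto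
  then have "N \<in> set R" using R' by simp
  then obtain u v where uv: "R = u @ N # v" "N \<notin> set v" by (metis split_list_last)
  then have "v \<noteq> []" using R(1) by auto
  then obtain t v' where t: "v = t # v'" by (cases v) auto
  then have v: "v = E # v'" using uv R(3) by (cases t) auto
  have "N \<notin> set w \<Longrightarrow> type_word w = []" for w
    by (induction w rule: type_word.induct) auto
  then have "type_word v = []" using uv(2) by blast
  moreover obtain c where "type_word R = c @ type_word (N # v)"
    using type_word_append_N[of u] uv(1) by blast
  ultimately show ?thesis using v by simp
qed

lemma Type_eq_iff:
  assumes "is_dyck R" "is_dyck S"
  shows "Type R = Type S \<longleftrightarrow> type_word R = type_word S"
  unfolding Type_eq[OF assms(1)] Type_eq[OF assms(2)]
  using last_type_word[OF assms(1)] last_type_word[OF assms(2)]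
  by (metis append_butlast_last_id)

text \<open>Every block ends in \<open>E\<close>, so its entries do not depend on the blocks after
  it.\<close>

lemma type_word_psi:
  "type_word (psi w) = concat (map (\<lambda>s. type_word (psi_step s)) w)"
proof (induction w)
  case (Cons s w)
  then show ?case by (cases s) auto
qed simp

section \<open>Covers under \<open>psi\<close> and their effect on types\<close>

lemma covers_psi:
  assumes "covers Q P"
  shows "covers (psi Q) (psi P)" "type_word (psi P) = type_word (psi Q)"
proof -
  obtain A X B where P: "P = A @ E # X @ B" "Q = A @ X @ E # B" "primitive X"
    using assms by (auto simp: covers_iff)
  then have "psi P = psi A @ E # psi X @ psi B" "psi Q = psi A @ psi X @ E # psi B"
    "primitive (psi X)"
    by (simp_all add: primitive_psi)
  then show "covers (psi Q) (psi P)" unfolding covers_iff by blast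
  \<comment> \<open>The block of \<open>E\<close> has empty type, so moving it changes
    nothing.\<close>
  show "type_word (psi P) = type_word (psi Q)"
    using P by (simp add: type_word_psi del: psi_simps(2,3))
qed

lemma psi_chain:
  assumes "(\<lambda>P Q. P \<in> motzkin_paths n \<and> Q \<in> motzkin_paths n \<and> covers Q P)\<^sup>*\<^sup>* P Q"
  shows "(\<lambda>P Q. P \<in> dyck_paths (2 * n) \<and> Q \<in> dyck_paths (2 * n) \<and> covers Q P)\<^sup>*\<^sup>* (psi P) (psi Q)
    \<and> type_word (psi P) = type_word (psi Q)"
  using assms
proof (induction rule: rtranclp_induct)
  case (step Q Q')
  then show ?case
    by (auto simp: psi_in_dyck_paths covers_psi intro: rtranclp.rtrancl_into_rtrancl)
qed simp

text \<open>Taking away the \<open>E\<close> before \<open>X\<close> matters only to a north step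
  directly in front of it. If \<open>A\<close> ends in \<open>N\<close>, the letter after that
  \<open>N\<close> becomes the first letter \<open>N\<close> of \<open>X\<close>.\<close>

lemma covers_cases:
  assumes "covers S R" "D \<notin> set R"
  obtains
    (type_eq) A X B where "R = A @ E # X @ B" "S = A @ X @ E # B" "primitive X"
      "A = [] \<or> last A = E" "type_word R = type_word S"
  | (type_less) "count_list (type_word R) E < count_list (type_word S) E"
proof -
  obtain A X B where RS: "R = A @ E # X @ B" "S = A @ X @ E # B" "primitive X"
    using assms by (auto simp: covers_iff)
  then obtain M where X: "X = N # M @ [E]"
    using assms(2) by (auto simp: primitive_def)
  \<comment> \<open>Doubling an \<open>E\<close> is invisible in the type. This accounts for the
    \<open>E\<close> reinserted after \<open>X\<close>, which itself ends in
    \<open>E\<close>.\<close>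
  have EE: "type_word (u @ E # E # v) = type_word (u @ E # v)" for u v
    by (metis type_word.simps(3) type_word_append_E)
  show thesis
  proof (cases "A = [] \<or> last A = E")
    case True
    have "type_word R = type_word S"
    proof (cases "A = []")
      case True
      then show ?thesis using RS X EE[of "N # M" B] by simp
    next
      case False
      then have "A = butlast A @ [E]" using True by (metis append_butlast_last_id)
      then obtain A' where "A = A' @ [E]" by blast
      then show ?thesis using RS X EE[of A' "N # M @ E # B"] EE[of "A' @ E # N # M" B] by simp
    qed
    then show ?thesis using type_eq RS True by blast
  next
    case False
    then have "last A = N" using RS(1) assms(2)
      by (cases "last A") (auto dest: last_in_set)
    then obtain A' where A: "A = A' @ [N]" using False by (metis append_butlast_last_id)
    obtain c where c: "\<And>v. type_word (A' @ N # v) = c @ type_word (N # v)"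
      using type_word_append_N by blast
    show ?thesis using RS A X c EE[of "N # M" B] type_less by simp
  qed
qed

text \<open>The moved \<open>E\<close> is a block by itself, since the other blocks begin with
  \<open>N\<close>. Without \<open>D\<close>, a primitive \<open>X\<close> ends in \<open>E\<close>,
  so the cut after it is a block boundary too.\<close>

lemma covers_lift:
  assumes "psi P = A @ E # X @ B" "S = A @ X @ E # B" "primitive X" "A = [] \<or> last A = E"
  obtains Q where "S = psi Q" "covers Q P"
proof -
  obtain P1 P2 where 1: "P = P1 @ P2" "psi P1 = A" "psi P2 = E # X @ B"
    using psi_split assms(1,4) by blast
  then obtain s P3 where s: "P2 = s # P3" by (cases P2) auto
  then have P3: "P2 = E # P3" "psi P3 = X @ B" using 1(3) by (cases s; simp)+
  have "D \<notin> set X" using D_notin_psi[of P] assms(1) by auto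
  then have "last X = E" using assms(3) by (auto simp: primitive_def)
  then obtain X' B' where 2: "P3 = X' @ B'" "psi X' = X" "psi B' = B"
    using psi_split P3(2) by metis
  have "covers (P1 @ X' @ E # B') P"
    unfolding covers_iff using 1 2 P3 assms(3) primitive_psi by auto
  moreover have "S = psi (P1 @ X' @ E # B')" using 1 2 assms(2) by simp
  ultimately show ?thesis using that by blast
qed

text \<open>The number of letters \<open>E\<close> in the type serves as a potential that no Dyck
  cover lowers.\<close>

lemma count_type_word_chain:
  assumes "(\<lambda>P Q. P \<in> dyck_paths m \<and> Q \<in> dyck_paths m \<and> covers Q P)\<^sup>*\<^sup>* R S"
  shows "count_list (type_word R) E \<le> count_list (type_word S) E"
  using assms
proof (induction rule: rtranclp_induct)
  case (step S S')
  then have "D \<notin> set S" by (auto simp: dyck_paths_def is_dyck_def)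
  with step have "count_list (type_word S) E \<le> count_list (type_word S') E"
    using covers_cases[of S' S] by (metis less_imp_le order_refl)
  then show ?case using step.IH by simp
qed simp

text \<open>The induction runs upward from \<open>R\<close>, because lifting a cover is what shows
  that the next path is again an image under \<open>psi\<close>. At the top, injectivity of
  \<open>psi\<close> identifies the lifted path with \<open>Q\<close>.\<close>

lemma chain_lift:
  assumes "(\<lambda>P Q. P \<in> dyck_paths (2 * n) \<and> Q \<in> dyck_paths (2 * n) \<and> covers Q P)\<^sup>*\<^sup>* R (psi Q)"
    and "count_list (type_word R) E = count_list (type_word (psi Q)) E" "R = psi P"
  shows "(\<lambda>P Q. P \<in> motzkin_paths n \<and> Q \<in> motzkin_paths n \<and> covers Q P)\<^sup>*\<^sup>* P Q"
  using assms
proof (induction arbitrary: P rule: converse_rtranclp_induct)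
  case base
  then show ?case using psi_inject by blast
next
  case (step R R')
  \<comment> \<open>The count at \<open>R'\<close> is at most that at \<open>psi Q\<close>, which
    equals that at \<open>R\<close>; this rules out \<open>type_less\<close>.\<close>
  have le: "count_list (type_word R') E \<le> count_list (type_word R) E"
    using count_type_word_chain[OF step.hyps(2)] step.prems(1) by simp
  have cov: "covers R' R" "D \<notin> set R"
    using step.hyps(1) by (auto simp: dyck_paths_def is_dyck_def)
  then show ?case
  proof (cases rule: covers_cases)
    case (type_eq A X B)
    then obtain P' where P': "R' = psi P'" "covers P' P"
      using covers_lift[of P A X B R'] step.prems(2) by auto
    have "(\<lambda>P Q. P \<in> motzkin_paths n \<and> Q \<in> motzkin_paths n \<and> covers Q P)\<^sup>*\<^sup>* P' Q"
      using step.IH[OF _ P'(1)] step.prems(1) type_eq(5) by simp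
    moreover have "P \<in> motzkin_paths n" "P' \<in> motzkin_paths n"
      using step.hyps(1) step.prems(2) P'(1) by (auto simp: psi_in_dyck_paths)
    ultimately show ?thesis using P'(2) by (auto intro: converse_rtranclp_into_rtranclp)
  next
    case type_less
    then show ?thesis using le by simp
  qed
qed

theorem theorem3p3:
  fixes R S P Q :: "step list"
  assumes "is_dyck R" and "avoids_NNN R"
    and "is_dyck S" and "avoids_NNN S"
    and "P = phi R" and "Q = phi S"
  shows "P \<le>\<^sub>M Q \<longleftrightarrow> R \<le>\<^sub>D S \<and> Type R = Type S"
proof -
  have R: "R = psi P" and S: "S = psi Q"
    using assms psi_phi by auto
  \<comment> \<open>The same \<open>n\<close> serves for both orders by
    \<open>psi_in_dyck_paths\<close>.\<close>
  have "path_le_on (motzkin_paths n) P Q \<longleftrightarrow>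
      path_le_on (dyck_paths (2 * n)) R S \<and> type_word R = type_word S" for n
    unfolding path_le_on_def R S psi_in_dyck_paths
    using psi_chain[of n P Q] chain_lift[of n "psi P" Q P] by auto
  then show ?thesis
    unfolding Type_eq_iff[OF assms(1,3)] motzkin_le_def dyck_le_def by blast
qed

end
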